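(* For every real $x\ge 1$, the sequence $(P_n(x))_{n\ge 0}$ of values of the Legendre polynomials at $x$ is log-convex.
   Context: $P_n$ denotes the $n$-th Legendre polynomial (with the standard normalization $P_n(1)=1$), i.e. $P_0(x)=1$, $P_1(x)=x$, $nP_n(x)=(2n-1)xP_{n-1}(x)-(n-1)P_{n-2}(x)$ for $n\ge2$. A sequence $(a(n))_{n\ge 0}$ of real numbers is log-convex if $a(n)^2\le a(n-1)a(n+1)$ for all $n\ge 1$. *)

theory Defs
  imports "HOL-Analysis.Analysis" "HOL-Computational_Algebra.Polynomial"
begin

text \<open>Bonnet's recursion, divided by the leading factor; the undivided form is
  \<open>legendre_poly_recurrence\<close> below.\<close>

fun legendre_poly :: "nat \<Rightarrow> real poly" where
  "legendre_poly 0 = 1"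
| "legendre_poly (Suc 0) = [:0, 1:]"
| "legendre_poly (Suc (Suc n)) =
     smult (1 / real (n + 2))
       (smult (real (2 * n + 3)) ([:0, 1:] * legendre_poly (Suc n))
        - smult (real (n + 1)) (legendre_poly n))"

lemma legendre_poly_recurrence:
  assumes "n \<ge> 2"
  shows "real n * poly (legendre_poly n) x
    = (2 * real n - 1) * x * poly (legendre_poly (n - 1)) x
      - (real n - 1) * poly (legendre_poly (n - 2)) x"
proof -
  obtain m where n: "n = Suc (Suc m)"
    using assms by (metis Suc_le_D numeral_2_eq_2 Suc_le_mono)
  have "poly (legendre_poly n) x = ((2 * real m + 3) * (x * poly (legendre_poly (Suc m)) x)
      - (real m + 1) * poly (legendre_poly m) x) / (real m + 2)"
    by (simp add: n add.commute)
  then have "(real m + 2) * poly (legendre_poly n) x = (2 * real m + 3) * (x * poly (legendre_poly (Suc m)) x)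
      - (real m + 1) * poly (legendre_poly m) x"
    by simp
  then show ?thesis by (simp add: n algebra_simps del: legendre_poly.simps)
qed

lemma poly_legendre_poly_1: "poly (legendre_poly n) 1 = 1"
  by (induction n rule: legendre_poly.induct) (simp_all add: field_simps)

definition log_convex_seq :: "(nat \<Rightarrow> real) \<Rightarrow> bool" where
  "log_convex_seq a \<longleftrightarrow> (\<forall>n\<ge>1. (a n)\<^sup>2 \<le> a (n - 1) * a (n + 1))"

end

theory Submission
  imports Defs
begin

text \<open>Write \<open>a, b, c\<close> for three consecutive values \<open>P\<^sub>n(x), P\<^sub>n\<^sub>+\<^sub>1(x), P\<^sub>n\<^sub>+\<^sub>2(x)\<close>.
  The form \<open>2xab - a\<^sup>2 - b\<^sup>2\<close> is symmetric, and equals \<open>(x\<^sup>2 - 1)b\<^sup>2 - (xb - a)\<^sup>2\<close>. Bonnet's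
  recursion reads \<open>(n + 2)(c - xb) = (n + 1)(xb - a)\<close>, so the form does not decrease with \<open>n\<close>
  and is at least its initial value \<open>x\<^sup>2 - 1\<close>. With \<open>d = P\<^sub>n\<^sub>+\<^sub>3(x)\<close>, the recursion also gives
  \<open>(n + 3)(bd - c\<^sup>2) = (n + 1)(ac - b\<^sup>2) + (2xbc - b\<^sup>2 - c\<^sup>2)\<close>,
  so the Turan determinants \<open>ac - b\<^sup>2\<close> are nonnegative by induction.\<close>

abbreviation legendre :: "real \<Rightarrow> nat \<Rightarrow> real" where
  "legendre x n \<equiv> poly (legendre_poly n) x"

lemma legendre_Suc_Suc:
  "(real n + 2) * legendre x (Suc (Suc n))
    = (2 * real n + 3) * x * legendre x (Suc n) - (real n + 1) * legendre x n"
  using legendre_poly_recurrence[of "Suc (Suc n)" x]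
  by (simp add: algebra_simps del: legendre_poly.simps)

lemma legendre_form_lower_bound:
  "x\<^sup>2 - 1 \<le> 2 * x * legendre x n * legendre x (Suc n) - (legendre x n)\<^sup>2 - (legendre x (Suc n))\<^sup>2"
proof (induction n)
  case 0
  show ?case by (simp add: power2_eq_square)
next
  case (Suc n)
  define a b c where "a = legendre x n" and "b = legendre x (Suc n)"
    and "c = legendre x (Suc (Suc n))"
  have "(real n + 2) * (c - x * b) = (real n + 1) * (x * b - a)"
    using legendre_Suc_Suc[of n x] unfolding a_def b_def c_def
    by (simp add: algebra_simps del: legendre_poly.simps)
  then have "c - x * b = (real n + 1) / (real n + 2) * (x * b - a)"
    by (simp add: field_simps)
  then have "\<bar>c - x * b\<bar> = (real n + 1) / (real n + 2) * \<bar>x * b - a\<bar>"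
    by (simp add: abs_mult)
  also have "\<dots> \<le> \<bar>x * b - a\<bar>"
    by (rule mult_left_le_one_le) auto
  finally have "(c - x * b)\<^sup>2 \<le> (x * b - a)\<^sup>2"
    by (simp add: abs_le_square_iff)
  \<comment> \<open>Add \<open>(x\<^sup>2 - 1) * b\<^sup>2\<close> to both negated squares; by
    symmetry of the form, \<open>b\<close> serves as the common middle value.\<close>
  then have "2 * x * a * b - a\<^sup>2 - b\<^sup>2 \<le> 2 * x * b * c - b\<^sup>2 - c\<^sup>2"
    by (simp add: power2_eq_square algebra_simps)
  then show ?case
    using Suc.IH unfolding a_def b_def c_def by linarith
qed

lemma legendre_Turan_step:
  "(real n + 3) * (legendre x (Suc n) * legendre x (Suc (Suc (Suc n))) - (legendre x (Suc (Suc n)))\<^sup>2)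
    = (real n + 1) * (legendre x n * legendre x (Suc (Suc n)) - (legendre x (Suc n))\<^sup>2)
      + (2 * x * legendre x (Suc n) * legendre x (Suc (Suc n))
          - (legendre x (Suc n))\<^sup>2 - (legendre x (Suc (Suc n)))\<^sup>2)"
proof -
  define a b c d where "a = legendre x n" and "b = legendre x (Suc n)"
    and "c = legendre x (Suc (Suc n))" and "d = legendre x (Suc (Suc (Suc n)))"
  have c: "(real n + 2) * c = (2 * real n + 3) * x * b - (real n + 1) * a"
    unfolding a_def b_def c_def d_def by (rule legendre_Suc_Suc)
  have d: "(real n + 3) * d = (2 * real n + 5) * x * c - (real n + 2) * b"
    using legendre_Suc_Suc[of "Suc n" x] unfolding a_def b_def c_def d_def
    by (simp add: algebra_simps del: legendre_poly.simps)
  \<comment> \<open>Multiply \<open>d\<close> by \<open>b\<close> and \<open>c\<close> by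
    \<open>c\<close>, then subtract: the \<open>x * b * c\<close> coefficients differ by (2n + 5) -
    (2n + 3) = 2.\<close>
  have "(real n + 3) * (b * d - c\<^sup>2)
      = (real n + 1) * (a * c - b\<^sup>2) + (2 * x * b * c - b\<^sup>2 - c\<^sup>2)"
    using c d by algebra
  then show ?thesis unfolding a_def b_def c_def d_def .
qed

lemma legendre_Turan_nonneg:
  assumes "1 \<le> x\<^sup>2"
  shows "0 \<le> legendre x n * legendre x (Suc (Suc n)) - (legendre x (Suc n))\<^sup>2"
proof (induction n)
  case 0
  \<comment> \<open>The second Legendre polynomial is (3x^2 - 1)/2, so this determinant is (x^2 -
    1)/2.\<close>
  show ?case using assms by (simp add: field_simps power2_eq_square)
next
  case (Suc n)
  have "0 \<le> (real n + 3) * (legendre x (Suc n) * legendre x (Suc (Suc (Suc n)))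
      - (legendre x (Suc (Suc n)))\<^sup>2)"
    unfolding legendre_Turan_step
    using assms legendre_form_lower_bound[of x "Suc n"]
    by (intro add_nonneg_nonneg mult_nonneg_nonneg Suc.IH) linarith+
  moreover have "0 < real n + 3" by simp
  ultimately show ?case by (simp only: zero_le_mult_iff) linarith
qed

theorem theorem2p4:
  fixes x :: real
  assumes "x \<ge> 1"
  shows "log_convex_seq (\<lambda>n. poly (legendre_poly n) x)"
  unfolding log_convex_seq_def
proof (intro allI impI)
  fix n :: nat
  assume "n \<ge> 1"
  then obtain m where "n = Suc m" by (cases n) auto
  moreover have "1 \<le> x\<^sup>2" using assms by simp
  ultimately show "(legendre x n)\<^sup>2 \<le> legendre x (n - 1) * legendre x (n + 1)"
    using legendre_Turan_nonneg[of x m] by (simp del: legendre_poly.simps)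
qed

end
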